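(* Let $b_0,b_1,b_2,\dots$ be indeterminates, $B(x)=\sum_{i\ge0}b_ix^i$, and let $g(x)$ be the unique formal power series with $g(x)=1+xg(x)B(x^2g(x))$. For a positive integer $m$, an integer $r\ge0$ and an integer $m_r\ge0$, let $\left(m\,|\,b_r^{m_r}\right)$ denote the coefficient of the monomial $b_r^{m_r}$ in $[x^{m_r(2r+1)}]g^m(x)$. Then $$\left(m\,|\,b_r^{m_r}\right)=[x^{m_r}]\mathcal{B}_{r+1}(x)^m=\frac{m}{m+rm_r}\binom{m+rm_r+m_r-1}{m_r}.$$
   Context: $[x^n]F(x)$ denotes the coefficient of $x^n$ in $F$. The generalized binomial series $\mathcal{B}_r(x)$ is defined by $\mathcal{B}_r(x)^m=\sum_{n\ge0}\frac{m}{m+rn}\binom{m+rn}{n}x^n$. *)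

theory Defs
  imports
    "HOL-Library.Poly_Mapping"
    "HOL-Computational_Algebra.Formal_Power_Series"
begin

unbundle fps_syntax

text \<open>
  Polynomials over \<open>'a\<close> in the indeterminates \<open>b\<^sub>0, b\<^sub>1, b\<^sub>2, \<dots>\<close>. A monomial is its finitely
  supported exponent vector, and \<open>Poly_Mapping.lookup p \<alpha>\<close> is the coefficient of \<open>b\<^sup>\<alpha>\<close> in \<open>p\<close>.
\<close>

type_synonym 'a bpoly = "(nat \<Rightarrow>\<^sub>0 nat) \<Rightarrow>\<^sub>0 'a"

definition b_var :: "nat \<Rightarrow> 'a::field_char_0 bpoly" where
  "b_var i = Poly_Mapping.single (Poly_Mapping.single i 1) 1"

definition B_ser :: "'a::field_char_0 bpoly fps" where
  "B_ser = Abs_fps b_var"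

definition g_ser :: "'a::field_char_0 bpoly fps" where
  "g_ser = (THE g. g = 1 + fps_X * g * (B_ser oo (fps_X\<^sup>2 * g)))"

text \<open>The coefficient \<open>(m | b\<^sub>r\<^sup>k)\<close> of the monomial \<open>b\<^sub>r\<^sup>k\<close> in \<open>[x\<^bsup>k(2r+1)\<^esup>] g(x)\<^sup>m\<close>.\<close>

definition mono_coeff :: "nat \<Rightarrow> nat \<Rightarrow> nat \<Rightarrow> 'a::field_char_0" where
  "mono_coeff m r k =
     Poly_Mapping.lookup ((g_ser ^ m :: 'a bpoly fps) $ (k * (2 * r + 1))) (Poly_Mapping.single r k)"

text \<open>
  The generalized binomial series is determined by the case \<open>m = 1\<close> of
  \<open>\<B>\<^sub>r(x)\<^sup>m = (\<Sum>n. m / (m + r n) * binomial (m + r n) n * x\<^sup>n)\<close>, which is taken as its definition.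
  The formula for the other powers is then a theorem. Since \<open>r\<close> is a natural number,
  the denominators do not vanish.
\<close>

definition gen_binomial_series :: "nat \<Rightarrow> 'a::field_char_0 fps" where
  "gen_binomial_series r =
     Abs_fps (\<lambda>n. 1 / of_nat (1 + r * n) * of_nat ((1 + r * n) choose n))"


definition fps_agree :: "nat \<Rightarrow> 'a::comm_ring_1 fps \<Rightarrow> 'a fps \<Rightarrow> bool" where
  "fps_agree n f h \<longleftrightarrow> (\<forall>k<n. f $ k = h $ k)"

lemma fps_agree_mult:
  assumes "fps_agree n f h" "fps_agree n f' h'"
  shows "fps_agree n (f * f') (h * h')"
  using assms unfolding fps_agree_def fps_mult_nth
  by (auto intro!: sum.cong)

lemma fps_agree_power: "fps_agree n f h \<Longrightarrow> fps_agree n (f ^ i) (h ^ i)"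
proof (induction i)
  case 0
  then show ?case by (simp add: fps_agree_def)
next
  case (Suc i)
  then show ?case using fps_agree_mult[of n f h "f ^ i" "h ^ i"] by simp
qed

lemma fps_agree_compose: "fps_agree n f h \<Longrightarrow> fps_agree n (a oo f) (a oo h)"
  using fps_agree_power[of n f h] unfolding fps_agree_def fps_compose_nth
  by (auto intro!: sum.cong)

lemma fps_agree_step:
  fixes a f h :: "'a::comm_ring_1 fps"
  assumes "fps_agree n f h"
  shows "fps_agree (Suc n) (1 + fps_X * f * (a oo (fps_X\<^sup>2 * f))) (1 + fps_X * h * (a oo (fps_X\<^sup>2 * h)))"
proof -
  have "fps_agree n (fps_X\<^sup>2 * f) (fps_X\<^sup>2 * h)"
    using assms by (intro fps_agree_mult) (auto simp: fps_agree_def)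
  then have "fps_agree n (f * (a oo (fps_X\<^sup>2 * f))) (h * (a oo (fps_X\<^sup>2 * h)))"
    by (rule fps_agree_mult[OF assms fps_agree_compose])
  then show ?thesis
    unfolding fps_agree_def mult.assoc by (auto simp: less_Suc_eq_0_disj)
qed

lemma ex1_functional_equation:
  fixes a :: "'a::comm_ring_1 fps"
  shows "\<exists>!g. g = 1 + fps_X * g * (a oo (fps_X\<^sup>2 * g))"
proof -
  define \<Phi> where "\<Phi> g = 1 + fps_X * g * (a oo (fps_X\<^sup>2 * g))" for g :: "'a fps"
  have step: "fps_agree (Suc n) (\<Phi> f) (\<Phi> h)" if "fps_agree n f h" for n f h
    using fps_agree_step[OF that, of a] by (simp add: \<Phi>_def)
  have eqI: "f = h" if "\<And>n. fps_agree n f h" for f h :: "'a fps"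
    using that by (metis fps_agree_def fps_eq_iff lessI)
  define s where "s n = (\<Phi> ^^ n) 0" for n
  have s_Suc: "s (Suc n) = \<Phi> (s n)" for n by (simp add: s_def)
  have s1: "fps_agree n (s n) (s (Suc n))" for n
  proof (induction n)
    case 0 then show ?case by (simp add: fps_agree_def)
  next
    case (Suc n) then show ?case using step s_Suc by metis
  qed
  have s: "fps_agree n (s n) (s (n + d))" for n d
  proof (induction d)
    case 0 then show ?case by (simp add: fps_agree_def)
  next
    case (Suc d) then show ?case using s1[of "n + d"] by (auto simp: fps_agree_def)
  qed
  define g where "g = Abs_fps (\<lambda>n. s (Suc n) $ n)"
  have gs: "fps_agree n (s n) g" for n
    unfolding fps_agree_def
  proof (intro allI impI)
    fix k assume "k < n"
    then show "s n $ k = g $ k"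
      using s[of "Suc k" "n - Suc k"] by (simp add: g_def fps_agree_def)
  qed
  have "fps_agree n g (\<Phi> g)" for n
    using gs[of "Suc n"] step[OF gs[of n]] by (simp add: s_Suc fps_agree_def)
  then have "g = \<Phi> g" by (rule eqI)
  moreover have "f = h" if "f = \<Phi> f" "h = \<Phi> h" for f h
  proof (rule eqI)
    show "fps_agree n f h" for n
    proof (induction n)
      case 0 then show ?case by (simp add: fps_agree_def)
    next
      case (Suc n) then show ?case using step that by metis
    qed
  qed
  ultimately show ?thesis unfolding \<Phi>_def[symmetric] by blast
qed

lemma g_ser_eq:
  "g_ser = 1 + fps_X * g_ser * (B_ser oo (fps_X\<^sup>2 * (g_ser :: 'a::field_char_0 bpoly fps)))"
  unfolding g_ser_def by (rule theI') (rule ex1_functional_equation)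

end

theory Submission
  imports Defs
begin

text \<open>
  Keeping only the powers of \<open>b\<^sub>r\<close> is a ring homomorphism onto series in one variable \<open>t\<close>. It turns
  the equation for \<open>g\<close> into \<open>G = 1 + t x\<^bsup>2r+1\<^esup> G\<^bsup>r+1\<^esup>\<close>, so by uniqueness \<open>G(x) = D(t x\<^bsup>2r+1\<^esup>)\<close>
  where \<open>D = 1 + x D\<^bsup>r+1\<^esup>\<close>. Multiplying the latter by \<open>D\<^sup>m\<close> gives
  \<open>[x\<^bsup>n+1\<^esup>] D\<^bsup>m+1\<^esup> = [x\<^bsup>n+1\<^esup>] D\<^sup>m + [x\<^sup>n] D\<^bsup>m+r+1\<^esup>\<close>, a recurrence that determines the coefficients of
  all powers of \<open>D\<close> and that the numbers \<open>m / (m + (r+1) n) * binomial (m + (r+1) n) n\<close> satisfy.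
\<close>

section \<open>Powers of the generalized binomial series\<close>

text \<open>Absorption makes every binomial here a rational multiple of \<open>N choose n\<close>.
  What remains is m (N - n) + (m + s) (n + 1) = N (m + 1), true because N = m + s (n + 1).\<close>

lemma gen_binomial_coeff_recurrence:
  fixes m n s :: nat
  assumes "s > 0"
  defines "N \<equiv> m + s * Suc n"
  shows "of_nat (Suc m) / of_nat (Suc N) * of_nat (Suc N choose Suc n) =
         (of_nat m / of_nat N * of_nat (N choose Suc n) +
          of_nat (m + s) / of_nat N * of_nat (N choose n) :: 'a::field_char_0)"
proof -
  have "s * Suc n \<ge> Suc n"
    using assms(1) by (cases s) auto
  then have le: "n < N"
    by (simp add: N_def)
  define c where "c = (of_nat (N choose n) :: 'a)"
  have c1: "of_nat (Suc N choose Suc n) = of_nat (Suc N) * c / of_nat (Suc n)"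
    using arg_cong[OF Suc_times_binomial[of n N], of "of_nat :: nat \<Rightarrow> 'a"]
    unfolding of_nat_mult c_def by (simp add: field_simps del: of_nat_Suc)
  have "(N choose Suc n) * Suc n = (N - n) * (N choose n)"
    using binomial_absorption[of n N] binomial_absorb_comp[of N n] by (simp add: mult.commute)
  then have c2: "of_nat (N choose Suc n) = (of_nat N - of_nat n) * c / of_nat (Suc n)"
    using le arg_cong[of _ _ "of_nat :: nat \<Rightarrow> 'a"]
    unfolding c_def by (metis eq_divide_eq of_nat_diff of_nat_mult less_imp_le of_nat_eq_0_iff nat.distinct(1))
  have nz: "(of_nat N :: 'a) \<noteq> 0" "(of_nat (Suc N) :: 'a) \<noteq> 0" "(of_nat (Suc n) :: 'a) \<noteq> 0"
    using le by (simp_all del: of_nat_Suc)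
  have N: "(of_nat N :: 'a) = of_nat m + of_nat s * of_nat (Suc n)"
    by (simp add: N_def algebra_simps)
  have "of_nat (Suc m) / of_nat (Suc N) * of_nat (Suc N choose Suc n) = of_nat (Suc m) * c / of_nat (Suc n)"
    unfolding c1 using nz by (simp del: of_nat_Suc)
  moreover have "of_nat m / of_nat N * of_nat (N choose Suc n) + of_nat (m + s) / of_nat N * c =
      (of_nat m * (of_nat N - of_nat n) + of_nat (m + s) * of_nat (Suc n)) * c / (of_nat N * of_nat (Suc n))"
    unfolding c2 using nz by (simp add: divide_simps del: of_nat_Suc) (simp add: algebra_simps)
  moreover have "of_nat m * (of_nat N - of_nat n) + of_nat (m + s) * of_nat (Suc n) =
      of_nat N * (of_nat (Suc m) :: 'a)"
    by (simp add: N algebra_simps)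
  ultimately show ?thesis
    using nz by (simp add: c_def del: of_nat_Suc)
qed

text \<open>The recurrence lowers n at the cost of raising the exponent to m + s, hence an outer
  induction on n for all m and an inner one on m. At m = n = 0 the formula would read 0 / 0, which
  is 0, whereas the coefficient is 1.\<close>

lemma power_nth_of_trinomial_equation:
  fixes D :: "'a::field_char_0 fps"
  assumes D: "D = 1 + fps_X * D ^ s" and "s > 0" and "m > 0 \<or> n > 0"
  shows "D ^ m $ n = of_nat m / of_nat (m + s * n) * of_nat ((m + s * n) choose n)"
  using assms(3)
proof (induction n arbitrary: m)
  case 0
  have "D $ 0 = 1"
    by (subst D) simp
  then show ?case
    using 0 by (simp add: fps_nth_power_0)
next
  case (Suc n)
  note IH = Suc.IH
  show ?case
  proof (induction m)
    case 0
    then show ?case by simp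
  next
    case (Suc m)
    have "D ^ Suc m = D ^ m * (1 + fps_X * D ^ s)"
      using D by (simp add: mult.commute)
    also have "\<dots> = D ^ m + fps_X * D ^ (m + s)"
      by (simp add: algebra_simps power_add)
    finally have "D ^ Suc m $ Suc n = D ^ m $ Suc n + D ^ (m + s) $ n"
      by simp
    \<comment> \<open>Since s > 0, the exponent m + s is positive, so the hypothesis for n applies
      even when n = 0.\<close>
    also have "D ^ (m + s) $ n =
        of_nat (m + s) / of_nat (m + s * Suc n) * of_nat ((m + s * Suc n) choose n)"
      using IH[of "m + s"] \<open>s > 0\<close> by (simp add: add.assoc)
    finally show ?case
      unfolding Suc.IH using gen_binomial_coeff_recurrence[OF \<open>s > 0\<close>, of m n, where 'a = 'a]
      by (simp only: add_Suc)
  qed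
qed

text \<open>The solution is \<open>D = 1 + y\<close> with \<open>y\<close> the compositional inverse of \<open>x / (1 + x)\<^sup>s\<close>.\<close>

lemma trinomial_equation_solvable:
  "\<exists>D :: 'a::field_char_0 fps. D = 1 + fps_X * D ^ s"
proof -
  define u where "u = ((1 + fps_X) ^ s :: 'a fps)"
  define a where "a = fps_X * inverse u"
  define y where "y = fps_inv a"
  have u0: "u $ 0 = 1"
    by (simp add: u_def fps_nth_power_0)
  have y0: "y $ 0 = 0"
    by (simp add: y_def fps_inv_def)
  have "a oo y = fps_X"
    unfolding y_def by (rule fps_inv_right) (simp_all add: a_def u0)
  \<comment> \<open>Substituting y into a u = x yields x (1 + y)^s = y.\<close>
  moreover have "a * u = fps_X"
    using u0 by (simp add: a_def mult.assoc inverse_mult_eq_1)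
  then have "(a oo y) * (u oo y) = y"
    using y0 by (metis fps_compose_mult_distrib fps_X_fps_compose_startby0)
  moreover have "u oo y = (1 + y) ^ s"
    using y0 by (simp add: u_def fps_compose_power[symmetric] fps_compose_add_distrib)
  ultimately have "1 + y = 1 + fps_X * (1 + y) ^ s"
    by simp
  then show ?thesis ..
qed

text \<open>Some solution D exists, and the coefficient formula at m = 1 identifies it with this
  series, so the equation transfers without any convolution of binomials.\<close>

lemma gen_binomial_series_eq:
  assumes "s > 0"
  shows "gen_binomial_series s = (1 + fps_X * gen_binomial_series s ^ s :: 'a::field_char_0 fps)"
proof -
  obtain D :: "'a fps" where D: "D = 1 + fps_X * D ^ s"
    using trinomial_equation_solvable by blast
  have "gen_binomial_series s = D"
    using power_nth_of_trinomial_equation[OF D assms, of 1]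
    by (simp add: fps_eq_iff gen_binomial_series_def)
  with D show ?thesis by metis
qed

section \<open>Coefficientwise ring homomorphisms\<close>

definition fps_map :: "('a \<Rightarrow> 'b) \<Rightarrow> 'a fps \<Rightarrow> 'b fps" where
  "fps_map h F = Abs_fps (\<lambda>n. h (F $ n))"

lemma fps_map_nth [simp]: "fps_map h F $ n = h (F $ n)"
  by (simp add: fps_map_def)

text \<open>Serves two maps into \<open>'a fps\<close>: the inclusion of constants and the
  restriction to powers of one indeterminate.\<close>

locale unital_ring_hom =
  fixes h :: "'a::comm_ring_1 \<Rightarrow> 'b::comm_ring_1"
  assumes hom_add: "h (x + y) = h x + h y"
    and hom_mult: "h (x * y) = h x * h y"
    and hom_one: "h 1 = 1"
begin

lemma hom_zero: "h 0 = 0"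
  using hom_add[of 0 0] by simp

lemma hom_sum: "h (sum f A) = (\<Sum>i\<in>A. h (f i))"
  by (induction A rule: infinite_finite_induct) (simp_all add: hom_zero hom_add)

lemma fps_map_one: "fps_map h 1 = 1"
  by (simp add: fps_eq_iff hom_zero hom_one)

lemma fps_map_X: "fps_map h fps_X = fps_X"
  by (simp add: fps_eq_iff hom_zero hom_one)

lemma fps_map_add: "fps_map h (F + G) = fps_map h F + fps_map h G"
  by (simp add: fps_eq_iff hom_add)

lemma fps_map_mult: "fps_map h (F * G) = fps_map h F * fps_map h G"
  by (simp add: fps_eq_iff fps_mult_nth hom_sum hom_mult)

lemma fps_map_power: "fps_map h (F ^ n) = fps_map h F ^ n"
  by (induction n) (simp_all add: fps_map_one fps_map_mult)

lemma fps_map_compose: "fps_map h (F oo G) = fps_map h F oo fps_map h G"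
  by (simp add: fps_eq_iff fps_compose_nth hom_sum hom_mult fps_map_power[symmetric])

end

interpretation fps_const_hom: unital_ring_hom "fps_const :: 'a::comm_ring_1 \<Rightarrow> 'a fps"
  by unfold_locales simp_all

section \<open>Restriction to the powers of one indeterminate\<close>

text \<open>This is the substitution of t for b_r and of 0 for every other indeterminate, with the
  result written as a power series in t.\<close>

definition restrict_to_var :: "nat \<Rightarrow> 'a::field_char_0 bpoly \<Rightarrow> 'a fps" where
  "restrict_to_var r p = Abs_fps (\<lambda>k. Poly_Mapping.lookup p (Poly_Mapping.single r k))"

text \<open>Exponents are natural numbers and cannot cancel, so a power of b_r factors only into
  powers of b_r. This makes the restriction multiplicative.\<close>

lemma add_eq_single_iff:
  fixes a b :: "nat \<Rightarrow>\<^sub>0 nat"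
  shows "a + b = Poly_Mapping.single r k \<longleftrightarrow>
    (\<exists>i\<le>k. a = Poly_Mapping.single r i \<and> b = Poly_Mapping.single r (k - i))"
proof
  assume ab: "a + b = Poly_Mapping.single r k"
  have sum: "Poly_Mapping.lookup a j + Poly_Mapping.lookup b j = (k when r = j)" for j
    using ab by (metis lookup_add lookup_single)
  have "a = Poly_Mapping.single r (Poly_Mapping.lookup a r)"
  proof (rule poly_mapping_eqI)
    fix j
    show "Poly_Mapping.lookup a j =
        Poly_Mapping.lookup (Poly_Mapping.single r (Poly_Mapping.lookup a r)) j"
      using sum[of j] by (auto simp: lookup_single when_def split: if_splits)
  qed
  moreover have "b = Poly_Mapping.single r (k - Poly_Mapping.lookup a r)"
  proof (rule poly_mapping_eqI)
    fix j
    show "Poly_Mapping.lookup b j =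
        Poly_Mapping.lookup (Poly_Mapping.single r (k - Poly_Mapping.lookup a r)) j"
      using sum[of j] by (auto simp: lookup_single when_def split: if_splits)
  qed
  moreover have "Poly_Mapping.lookup a r \<le> k"
    using sum[of r] by simp
  ultimately show "\<exists>i\<le>k. a = Poly_Mapping.single r i \<and> b = Poly_Mapping.single r (k - i)"
    by blast
qed (auto simp: single_add[symmetric])

lemma restrict_to_var_mult:
  "restrict_to_var r (p * q) = restrict_to_var r p * restrict_to_var r q"
proof (rule fps_ext)
  fix k
  let ?pr = "\<lambda>i. (Poly_Mapping.single r i, Poly_Mapping.single r (k - i)) :: (nat \<Rightarrow>\<^sub>0 nat) \<times> (nat \<Rightarrow>\<^sub>0 nat)"
  let ?f = "\<lambda>(a, b). Poly_Mapping.lookup p a * Poly_Mapping.lookup q b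
              when Poly_Mapping.single r k = a + b"
  have "Poly_Mapping.lookup (p * q) (Poly_Mapping.single r k) = Sum_any ?f"
    by (simp add: times_poly_mapping.rep_eq prod_fun_unfold_prod)
  \<comment> \<open>Only the k + 1 splittings of b_r^k into two powers of b_r contribute, which
    leaves a Cauchy product.\<close>
  also have "\<dots> = sum ?f (?pr ` {0..k})"
  proof (rule Sum_any.expand_superset)
    show "{x. ?f x \<noteq> 0} \<subseteq> ?pr ` {0..k}"
    proof (rule subsetI)
      fix x assume "x \<in> {x. ?f x \<noteq> 0}"
      then have "fst x + snd x = Poly_Mapping.single r k"
        by (auto simp: when_def split: prod.splits if_splits)
      then show "x \<in> ?pr ` {0..k}"
        unfolding add_eq_single_iff by (force simp: prod_eq_iff)
    qed
  qed simp
  \<comment> \<open>The pairs are distinct: the first component looked up at r gives back i.\<close>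
  also have "\<dots> = (\<Sum>i=0..k. ?f (?pr i))"
    by (rule sum.reindex[unfolded o_def]) (auto intro!: inj_onI dest: arg_cong[of _ _ "\<lambda>a. Poly_Mapping.lookup a r"])
  also have "\<dots> = (\<Sum>i=0..k. Poly_Mapping.lookup p (Poly_Mapping.single r i) *
                          Poly_Mapping.lookup q (Poly_Mapping.single r (k - i)))"
    by (rule sum.cong) (simp_all add: single_add[symmetric])
  finally show "restrict_to_var r (p * q) $ k = (restrict_to_var r p * restrict_to_var r q) $ k"
    by (simp add: restrict_to_var_def fps_mult_nth)
qed

interpretation restrict_to_var_hom: unital_ring_hom "restrict_to_var r :: 'a::field_char_0 bpoly \<Rightarrow> 'a fps"
proof
  fix x y :: "'a bpoly"
  show "restrict_to_var r (x + y) = restrict_to_var r x + restrict_to_var r y"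
    by (simp add: restrict_to_var_def fps_eq_iff lookup_add)
  show "restrict_to_var r (x * y) = restrict_to_var r x * restrict_to_var r y"
    by (rule restrict_to_var_mult)
  have "Poly_Mapping.single r k = 0 \<longleftrightarrow> k = 0" for k :: nat
    by (metis lookup_single_eq lookup_zero single_zero)
  then show "restrict_to_var r (1 :: 'a bpoly) = 1"
    by (auto simp: restrict_to_var_def fps_eq_iff lookup_one when_def)
qed

lemma restrict_to_var_b_var:
  "restrict_to_var r (b_var i :: 'a::field_char_0 bpoly) = (if i = r then fps_X else 0)"
proof -
  have "Poly_Mapping.single i (1::nat) = Poly_Mapping.single r k \<longleftrightarrow> i = r \<and> k = 1" for k
    by (metis lookup_single_eq lookup_single_not_eq zero_neq_one)
  then show ?thesis
    by (auto simp: restrict_to_var_def b_var_def fps_eq_iff lookup_single when_def)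
qed

lemma fps_map_restrict_to_var_B_ser:
  "fps_map (restrict_to_var r) (B_ser :: 'a::field_char_0 bpoly fps) = fps_const fps_X * fps_X ^ r"
  by (simp add: fps_eq_iff B_ser_def restrict_to_var_b_var)

text \<open>Here \<open>fps_const fps_X\<close> is \<open>t\<close>, the image of \<open>b\<^sub>r\<close>, and the outer \<open>fps_X\<close> is \<open>x\<close>.\<close>

lemma fps_map_restrict_to_var_g_ser:
  "fps_map (restrict_to_var r) (g_ser :: 'a::field_char_0 bpoly fps) =
   fps_map fps_const (gen_binomial_series (r + 1)) oo (fps_const fps_X * fps_X ^ (2 * r + 1))"
  (is "?G = ?H")
proof -
  let ?B = "fps_const fps_X * fps_X ^ r :: 'a fps fps"
  let ?z = "fps_const fps_X * fps_X ^ (2 * r + 1) :: 'a fps fps"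
  let ?D = "gen_binomial_series (r + 1) :: 'a fps"
  have B: "?B oo (fps_X\<^sup>2 * F) = fps_const fps_X * (fps_X\<^sup>2 * F) ^ r" for F
    by (simp add: fps_compose_mult_distrib fps_compose_power[symmetric])
  have "?G = 1 + fps_X * ?G * (?B oo (fps_X\<^sup>2 * ?G))"
    using arg_cong[OF g_ser_eq[where 'a = 'a], of "fps_map (restrict_to_var r)"]
    by (simp only: restrict_to_var_hom.fps_map_one restrict_to_var_hom.fps_map_X
        restrict_to_var_hom.fps_map_add restrict_to_var_hom.fps_map_mult
        restrict_to_var_hom.fps_map_power restrict_to_var_hom.fps_map_compose
        fps_map_restrict_to_var_B_ser)
  moreover have "?H = 1 + fps_X * ?H * (?B oo (fps_X\<^sup>2 * ?H))"
  proof -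
    have z0: "?z $ 0 = 0" by simp
    have "?D = 1 + fps_X * ?D ^ (r + 1)"
      by (rule gen_binomial_series_eq) simp
    from arg_cong[OF this, of "fps_map fps_const"]
    have "fps_map fps_const ?D = 1 + fps_X * fps_map fps_const ?D ^ (r + 1)"
      by (simp only: fps_const_hom.fps_map_one fps_const_hom.fps_map_X
          fps_const_hom.fps_map_add fps_const_hom.fps_map_mult fps_const_hom.fps_map_power)
    from arg_cong[OF this, of "\<lambda>F. F oo ?z"]
    have "?H = 1 + ?z * ?H ^ (r + 1)"
      by (simp only: fps_compose_add_distrib fps_compose_mult_distrib[OF z0]
          fps_compose_power[OF z0, symmetric] fps_compose_1 fps_X_fps_compose_startby0[OF z0])
    \<comment> \<open>The factors x H and t (x^2 H)^r together contribute x^(2r+1) and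
      H^(r+1).\<close>
    also have "?z * ?H ^ (r + 1) = fps_X * ?H * (?B oo (fps_X\<^sup>2 * ?H))"
      unfolding B by (simp add: power_mult_distrib power_mult[symmetric] ac_simps)
    finally show ?thesis .
  qed
  \<comment> \<open>Uniqueness holds over every commutative ring, hence also over
    \<open>'a fps\<close> with \<open>?B\<close> in place of \<open>B_ser\<close>.\<close>
  ultimately show ?thesis
    using ex1_functional_equation[of ?B] by blast
qed

text \<open>In D(t x^(2r+1))^m the power x^(k(2r+1)) comes only from the k-th term of D^m and
  carries t^k, so extracting first in x and then in t leaves the k-th coefficient of D^m.\<close>

lemma mono_coeff_eq_gen_binomial_series_power:
  "mono_coeff m r k = (gen_binomial_series (r + 1) ^ m :: 'a::field_char_0 fps) $ k"
proof -
  let ?d = "2 * r + 1"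
  let ?z = "fps_const fps_X * fps_X ^ ?d :: 'a fps fps"
  let ?D = "gen_binomial_series (r + 1) :: 'a fps"
  have z: "?z ^ i $ (k * ?d) = (if i = k then fps_X ^ k else 0)" for i
  proof -
    have "?z ^ i = fps_const (fps_X ^ i) * fps_X ^ (i * ?d)"
      by (simp only: power_mult_distrib fps_const_power power_mult[symmetric] mult.commute[of i])
    moreover have "k * ?d = i * ?d \<longleftrightarrow> i = k"
      by (subst mult_cancel2) auto
    ultimately show ?thesis
      by (simp only: fps_mult_left_const_nth fps_X_power_nth) simp
  qed
  have "mono_coeff m r k = fps_map (restrict_to_var r) (g_ser ^ m :: 'a bpoly fps) $ (k * ?d) $ k"
    by (simp add: mono_coeff_def restrict_to_var_def)
  also have "fps_map (restrict_to_var r) (g_ser ^ m :: 'a bpoly fps) = fps_map fps_const (?D ^ m) oo ?z"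
    by (simp only: restrict_to_var_hom.fps_map_power fps_map_restrict_to_var_g_ser
        fps_const_hom.fps_map_power) (rule fps_compose_power, simp)
  also have "\<dots> $ (k * ?d) = (\<Sum>i=0..k * ?d. if i = k then fps_const (?D ^ m $ k) * fps_X ^ k else 0)"
    unfolding fps_compose_nth z by (intro sum.cong) auto
  \<comment> \<open>The index k lies in the summation range because \<open>?d\<close> is at least
    1.\<close>
  also have "\<dots> = fps_const (?D ^ m $ k) * fps_X ^ k"
    by (subst sum.delta) auto
  finally show ?thesis
    by simp
qed

theorem theorem5:
  fixes m r m\<^sub>r :: nat
  assumes "m > 0"
  shows "(mono_coeff m r m\<^sub>r :: 'a::field_char_0) = (gen_binomial_series (r + 1) ^ m) $ m\<^sub>r \<and>
         ((gen_binomial_series (r + 1) ^ m) $ m\<^sub>r :: 'a) =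
           of_nat m / of_nat (m + r * m\<^sub>r) * of_nat ((m + r * m\<^sub>r + m\<^sub>r - 1) choose m\<^sub>r)"
proof
  show "(mono_coeff m r m\<^sub>r :: 'a) = (gen_binomial_series (r + 1) ^ m) $ m\<^sub>r"
    by (rule mono_coeff_eq_gen_binomial_series_power)
  \<comment> \<open>M is the denominator in the power formula for s = r + 1; absorption trades m / M
    times \<open>M choose m\<^sub>r\<close> for the stated form with upper index M - 1.\<close>
  define M where "M = m + (r + 1) * m\<^sub>r"
  have "(M - m\<^sub>r) * (M choose m\<^sub>r) = M * ((M - 1) choose m\<^sub>r)"
    by (rule binomial_absorb_comp)
  moreover have "M - m\<^sub>r = m + r * m\<^sub>r" "M - 1 = m + r * m\<^sub>r + m\<^sub>r - 1"
    by (simp_all add: M_def)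
  ultimately have "(m + r * m\<^sub>r) * (M choose m\<^sub>r) = M * ((m + r * m\<^sub>r + m\<^sub>r - 1) choose m\<^sub>r)"
    by simp
  then have "(of_nat (m + r * m\<^sub>r) * of_nat (M choose m\<^sub>r) :: 'a) =
      of_nat M * of_nat ((m + r * m\<^sub>r + m\<^sub>r - 1) choose m\<^sub>r)"
    by (metis of_nat_mult)
  \<comment> \<open>Positivity of m keeps both denominators nonzero, even for r = 0 or
    \<open>m\<^sub>r = 0\<close>.\<close>
  moreover have "(of_nat (m + r * m\<^sub>r) :: 'a) \<noteq> 0" "(of_nat M :: 'a) \<noteq> 0"
    using assms by (simp_all only: of_nat_eq_0_iff M_def)
  ultimately have "(of_nat (M choose m\<^sub>r) / of_nat M :: 'a) =
      of_nat ((m + r * m\<^sub>r + m\<^sub>r - 1) choose m\<^sub>r) / of_nat (m + r * m\<^sub>r)"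
    by (metis frac_eq_eq mult.commute)
  moreover have "(gen_binomial_series (r + 1) ^ m) $ m\<^sub>r = (of_nat m / of_nat M * of_nat (M choose m\<^sub>r) :: 'a)"
    unfolding M_def using assms
    by (intro power_nth_of_trinomial_equation gen_binomial_series_eq) simp_all
  ultimately show "((gen_binomial_series (r + 1) ^ m) $ m\<^sub>r :: 'a) =
      of_nat m / of_nat (m + r * m\<^sub>r) * of_nat ((m + r * m\<^sub>r + m\<^sub>r - 1) choose m\<^sub>r)"
    by (metis times_divide_eq_left times_divide_eq_right)
qed

end
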